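(* For every $k\ge1$ and all odd primes $p_1<\cdots<p_k$ with $p_1\cdots p_{k-1}<1000$, we have $g(\Phi_{p_1\cdots p_k})=\varphi(p_1\cdots p_{k-1})$ if and only if $p_k>p_1\cdots p_{k-1}$.
   Context: $\Phi_N(x)=\prod_{1\le j\le N,\ \gcd(j,N)=1}(x-e^{2\pi i j/N})$ is the $N$-th cyclotomic polynomial; $\varphi$ is Euler's totient ($\varphi(1)=1$, the empty product being $1$). For a polynomial $f=c_1x^{\nu_1}+\cdots+c_tx^{\nu_t}$ with all $c_i\ne0$, $0\le\nu_1<\cdots<\nu_t$, the maximum gap is $g(f)=\max_{1\le i<t}(\nu_{i+1}-\nu_i)$ if $t\ne1$ and $g(f)=0$ if $t=1$. *)

theory Defs
  imports
    Complex_Main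
    "HOL-Computational_Algebra.Polynomial"
    "HOL-Number_Theory.Totient"
begin

definition cyclotomic_poly :: "nat \<Rightarrow> complex poly" where
  "cyclotomic_poly N =
     (\<Prod>j | 1 \<le> j \<and> j \<le> N \<and> gcd j N = 1.
        [:- exp (2 * of_real pi * \<i> * of_nat j / of_nat N), 1:])"

text \<open>The exponents $\nu_1 < \dots < \nu_t$ of the nonzero terms, as a list indexed from 0.\<close>

definition exponents :: "'a::zero poly \<Rightarrow> nat list" where
  "exponents f = sorted_list_of_set {n. coeff f n \<noteq> 0}"

text \<open>The maximum is over consecutive pairs, so it is undefined for fewer than two terms:
  a monomial has gap 0 by convention, and the zero polynomial (no terms) is given the same value.\<close>

definition max_gap :: "'a::zero poly \<Rightarrow> nat" where
  "max_gap f =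
     (let \<nu> = exponents f; t = length \<nu> in
      if t \<le> 1 then 0 else Max {\<nu> ! (i + 1) - \<nu> ! i | i. i + 1 < t})"

end

theory Submission
  imports Defs "HOL-Analysis.Complex_Transcendental" "HOL-Computational_Algebra.Squarefree"
begin

text \<open>
  Put $F = \Phi_m$, $\varphi = \deg F$, $C = \Phi_{mp}$ and $F P = x^m - 1$, so that
  $C(x) F(x) = F(x^p)$. If $C$ has no exponents strictly between $n - \varphi$ and $n$, then cutting
  off $C$ below $n$ in this identity gives $A(x^p) \equiv K x^n \pmod F$, where
  $A$ is the truncation of $F$ to degree at most $i = \lfloor (n-1)/p \rfloor$ and
  $-K$ is the coefficient of $C$ at $n - \varphi$; as $p$ is coprime to $m$, then also
  $A \equiv K x^l \pmod F$ with $pl \equiv n \pmod m$ and $0 \le l < m$. A gap exceeding $\varphi$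
  would give $K = 0$, which is impossible for the nonzero polynomial $A$ of degree less than $\varphi$.

  For a gap equal to $\varphi$ there are three cases. If $l < \varphi$ then $A$ is constant; as $m$ is squarefree,
  $F$ has a nonzero linear coefficient, so $i = l = 0$ and $m$ divides $n \le p$. If $l = \varphi$ then
  $A = F - x^\varphi$; the coefficient of $F$ at $\varphi - 1$ is nonzero too, so $i = \varphi - 1$
  and $m$ divides $p\varphi - n \in (0, p)$. Both force $p > m$. If $l > \varphi$, comparing coefficients of
  $A P \equiv K x^l P \pmod{x^m - 1}$ gives $i + 1 + \varphi \le l \le i + m - \varphi$, so
  $2\varphi < m$, and $P$ has at most one nonzero coefficient with index in
  $[m - 2\varphi, \varphi]$. Below 1000 only $m = 15q$ with $q \in \{7, 11, 13\}$ satisfies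
  $2\varphi < m$, and there the coefficients of $P$ at $q+3$ and $q+4$ are both nonzero.
  Conversely, for $p > m$ the lowest $m + 1$ coefficients of $C$ exhibit the gap between
  $m - \varphi$ and $m$.
\<close>

section \<open>Gaps\<close>

text \<open>Adjacency in the list \<open>exponents\<close>, expressed by coefficients so that later
  arguments need no list indices.\<close>

definition consecutive_exponents :: "'a::zero poly \<Rightarrow> nat \<Rightarrow> nat \<Rightarrow> bool" where
  "consecutive_exponents f a b \<longleftrightarrow>
     a < b \<and> coeff f a \<noteq> 0 \<and> coeff f b \<noteq> 0 \<and> (\<forall>j. a < j \<and> j < b \<longrightarrow> coeff f j = 0)"

text \<open>The list enumerates the support in strictly increasing order, so list neighbours are the
  pairs with no support in between.\<close>

lemma consecutive_exponents_iff_nth: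
  "consecutive_exponents f a b \<longleftrightarrow>
     (\<exists>i. i + 1 < length (exponents f) \<and> a = exponents f ! i \<and> b = exponents f ! (i + 1))"
proof -
  define xs where "xs = exponents f"
  have "finite {n. coeff f n \<noteq> 0}"
    using MOST_coeff_eq_0[of f] by (simp add: MOST_iff_cofinite)
  hence set_xs: "set xs = {n. coeff f n \<noteq> 0}" and srt: "sorted_wrt (<) xs"
    by (simp_all add: xs_def exponents_def)
  have lt: "xs ! i < xs ! j \<longleftrightarrow> i < j" if "i < length xs" "j < length xs" for i j
    using that sorted_wrt_nth_less[OF srt] by (metis linorder_neqE_nat order_less_asym)
  have "consecutive_exponents f a b \<longleftrightarrow> (\<exists>i. i + 1 < length xs \<and> a = xs ! i \<and> b = xs ! (i + 1))"
  proof
    assume *: "consecutive_exponents f a b"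
    hence "a \<in> set xs" "b \<in> set xs"
      by (auto simp: consecutive_exponents_def set_xs)
    then obtain i j where ij: "i < length xs" "a = xs ! i" "j < length xs" "b = xs ! j"
      by (metis in_set_conv_nth)
    have "i < j" using * ij lt by (auto simp: consecutive_exponents_def)
    moreover have "\<not> i + 1 < j"
    proof
      assume "i + 1 < j"
      hence "a < xs ! (i + 1)" "xs ! (i + 1) < b" using ij lt by auto
      moreover have "coeff f (xs ! (i + 1)) \<noteq> 0"
        using set_xs ij \<open>i + 1 < j\<close> nth_mem[of "i + 1" xs] by auto
      ultimately show False using * by (auto simp: consecutive_exponents_def)
    qed
    ultimately have "j = i + 1" by simp
    thus "\<exists>i. i + 1 < length xs \<and> a = xs ! i \<and> b = xs ! (i + 1)" using ij by blast
  next
    assume "\<exists>i. i + 1 < length xs \<and> a = xs ! i \<and> b = xs ! (i + 1)"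
    then obtain i where i: "i + 1 < length xs" "a = xs ! i" "b = xs ! (i + 1)" by blast
    have "coeff f j = 0" if "a < j" "j < b" for j
    proof (rule ccontr)
      assume "coeff f j \<noteq> 0"
      then obtain l where "l < length xs" "j = xs ! l"
        using set_xs by (metis (mono_tags) in_set_conv_nth mem_Collect_eq)
      thus False using that i lt[of i l] lt[of l "i + 1"] by auto
    qed
    moreover have "coeff f a \<noteq> 0" "coeff f b \<noteq> 0"
      using i set_xs nth_mem[of i xs] nth_mem[of "i + 1" xs] by auto
    ultimately show "consecutive_exponents f a b"
      using i lt[of i "i + 1"] by (auto simp: consecutive_exponents_def)
  qed
  thus ?thesis by (simp add: xs_def)
qed

text \<open>As \<open>d > 0\<close>, the default value 0 of \<open>max_gap\<close> is ruled out;
  what remains is a maximum of a finite set, an attained upper bound.\<close>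

lemma max_gap_eq_iff:
  assumes "d > 0"
  shows "max_gap f = d \<longleftrightarrow>
    (\<exists>a. consecutive_exponents f a (a + d)) \<and>
    (\<forall>a b. consecutive_exponents f a b \<longrightarrow> b - a \<le> d)"
proof -
  define xs where "xs = exponents f"
  define G where "G = {xs ! (i + 1) - xs ! i | i. i + 1 < length xs}"
  have G: "g \<in> G \<longleftrightarrow> (\<exists>a b. consecutive_exponents f a b \<and> g = b - a)" for g
    unfolding G_def consecutive_exponents_iff_nth xs_def by blast
  have fin: "finite G"
    unfolding G_def by (rule finite_image_set) (rule finite_subset[of _ "{..<length xs}"], auto)
  have empty: "G = {} \<longleftrightarrow> length xs \<le> 1"
  proof -
    have "0 + 1 < length xs" if "\<not> length xs \<le> 1" using that by simp
    hence "\<exists>i. i + 1 < length xs" if "\<not> length xs \<le> 1" using that by blast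
    thus ?thesis unfolding G_def by auto
  qed
  have "max_gap f = (if G = {} then 0 else Max G)"
    unfolding max_gap_def Let_def empty by (simp add: G_def xs_def)
  hence "max_gap f = d \<longleftrightarrow> d \<in> G \<and> (\<forall>g\<in>G. g \<le> d)"
    using assms fin by (auto simp: Max_eq_iff)
  also have "d \<in> G \<longleftrightarrow> (\<exists>a. consecutive_exponents f a (a + d))"
  proof
    assume "d \<in> G"
    then obtain a b where ab: "consecutive_exponents f a b" "d = b - a" unfolding G by blast
    moreover have "b = a + d" using ab by (simp add: consecutive_exponents_def)
    ultimately show "\<exists>a. consecutive_exponents f a (a + d)" by metis
  qed (use G in force)
  also have "(\<forall>g\<in>G. g \<le> d) \<longleftrightarrow> (\<forall>a b. consecutive_exponents f a b \<longrightarrow> b - a \<le> d)"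
    by (metis G)
  finally show ?thesis .
qed

section \<open>Truncations congruent to monomials\<close>

lemma coeff_pcompose_monom:
  fixes f :: "'a::comm_semiring_1 poly"
  assumes "n > 0"
  shows "coeff (pcompose f (monom 1 n)) k = (if n dvd k then coeff f (k div n) else 0)"
proof (induction f arbitrary: k)
  case (pCons a f)
  show ?case
  proof (cases "k < n")
    case True
    thus ?thesis using assms
      by (auto simp: pcompose_pCons coeff_monom_mult coeff_pCons dvd_imp_le split: nat.splits)
  next
    case False
    moreover have "k div n = Suc ((k - n) div n)"
      using False assms by (simp add: le_div_geq)
    moreover have "n dvd k - n \<longleftrightarrow> n dvd k" using False by (simp add: dvd_minus_self)
    ultimately show ?thesis using pCons.IH assms
      by (auto simp: pcompose_pCons coeff_monom_mult coeff_pCons split: nat.splits)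
  qed
qed simp

lemma coeff_mult_eq_single:
  assumes "a \<le> k" "\<And>i. i \<le> k \<Longrightarrow> i \<noteq> a \<Longrightarrow> coeff f i * coeff g (k - i) = 0"
  shows "coeff (f * g) k = coeff f a * coeff g (k - a)"
proof -
  have "coeff (f * g) k = (\<Sum>i\<in>{a}. coeff f i * coeff g (k - i))"
    unfolding coeff_mult using assms by (intro sum.mono_neutral_right) auto
  thus ?thesis by simp
qed

lemma degree_monom_diff_1:
  assumes "m > 0"
  shows "degree (monom 1 m - 1 :: 'a::comm_ring_1 poly) = m"
proof (rule antisym)
  show "degree (monom 1 m - 1 :: 'a poly) \<le> m" by (auto intro!: degree_le simp: coeff_1)
  show "m \<le> degree (monom 1 m - 1 :: 'a poly)" using assms by (auto intro!: le_degree simp: coeff_1)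
qed

text \<open>Cutting \<open>C\<close> at n and multiplying by \<open>F\<close> reproduces F(x^p)
  below n. The window bounds the degree of the cut polynomial by n - deg \<open>F\<close>, so one
  product survives at n and none beyond.\<close>

lemma dvd_truncation_if_window:
  fixes F C :: "'a::idom poly"
  assumes CF: "C * F = pcompose F (monom 1 p)" and p: "p > 0"
    and F: "lead_coeff F = 1" "degree F > 0" and n: "degree F \<le> n"
    and zero: "\<And>j. n - degree F < j \<Longrightarrow> j < n \<Longrightarrow> coeff C j = 0"
  shows "F dvd pcompose (poly_cutoff ((n - 1) div p + 1) F) (monom 1 p)
           + monom (coeff C (n - degree F)) n"
proof -
  define A where "A = poly_cutoff ((n - 1) div p + 1) F"
  define D where "D = poly_cutoff n C"
  \<comment> \<open>A multiple k of p is below n exactly if k div p is at most (n - 1) div p, so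
    \<open>A\<close> keeps precisely the terms of F(x^p) below n.\<close>
  have below: "k div p \<le> (n - 1) div p" if "k < n" for k
    using that by (intro div_le_mono) auto
  have above: "(n - 1) div p < k div p" if "p dvd k" "n \<le> k" for k
  proof -
    obtain l where l: "k = p * l" using \<open>p dvd k\<close> by blast
    have "n - 1 < p * l" using that n F l by linarith
    thus ?thesis using p l by (simp add: less_mult_imp_div_less mult.commute)
  qed
  have D0: "coeff D i = 0" if "i > n - degree F" for i
    using that zero by (auto simp: D_def coeff_poly_cutoff)
  have "coeff (D * F) k = coeff (pcompose A (monom 1 p) + monom (coeff C (n - degree F)) n) k" for k
  proof (cases k n rule: linorder_cases)
    case less
    have "coeff (D * F) k = coeff (C * F) k"
      unfolding coeff_mult D_def using less by (intro sum.cong) (auto simp: coeff_poly_cutoff)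
    thus ?thesis using less below[OF less] p
      by (simp add: CF coeff_pcompose_monom A_def coeff_poly_cutoff)
  next
    case equal
    have "coeff (D * F) n = coeff D (n - degree F) * coeff F (n - (n - degree F))"
    proof (rule coeff_mult_eq_single)
      fix i assume "i \<le> n" "i \<noteq> n - degree F"
      thus "coeff D i * coeff F (n - i) = 0"
        using D0[of i] coeff_eq_0[of F "n - i"] n by (cases "i > n - degree F") auto
    qed simp
    thus ?thesis using equal above[of n] p F n
      by (auto simp: coeff_pcompose_monom A_def coeff_poly_cutoff D_def)
  next
    case greater
    have "coeff D i * coeff F (k - i) = 0" for i
    proof (cases "i > n - degree F")
      case False
      hence "degree F < k - i" using greater n by linarith
      thus ?thesis by (simp add: coeff_eq_0)
    qed (simp add: D0)
    hence "coeff (D * F) k = 0" unfolding coeff_mult by (intro sum.neutral) blast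
    thus ?thesis using greater above[of k] p
      by (auto simp: coeff_pcompose_monom A_def coeff_poly_cutoff)
  qed
  hence "pcompose A (monom 1 p) + monom (coeff C (n - degree F)) n = D * F"
    by (simp add: poly_eq_iff)
  thus ?thesis unfolding A_def by simp
qed

text \<open>Both summands have degree below that of \<open>F\<close>.\<close>

lemma truncation_eq_monom:
  fixes F :: "'a::idom poly"
  assumes "F dvd poly_cutoff (i + 1) F + monom c l" "i < degree F" "l < degree F"
  shows "poly_cutoff (i + 1) F + monom c l = 0"
proof (rule ccontr)
  assume *: "poly_cutoff (i + 1) F + monom c l \<noteq> 0"
  hence "degree F \<le> degree (poly_cutoff (i + 1) F + monom c l)"
    using assms dvd_imp_degree_le by blast
  moreover have "coeff (poly_cutoff (i + 1) F + monom c l) k = 0" if "k \<ge> degree F" for k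
    using that assms by (simp add: coeff_poly_cutoff)
  ultimately show False using * by (metis leading_coeff_0_iff)
qed

text \<open>The quotient by \<open>F\<close> is constant, and the constant terms show it to be 1;
  hence the truncation retains the nonzero coefficient just below the leading one.\<close>

lemma truncation_monom_degree:
  fixes F :: "'a::idom poly"
  assumes "F dvd poly_cutoff (i + 1) F + monom c (degree F)" "i < degree F"
    and "lead_coeff F = 1" "coeff F 0 \<noteq> 0" "coeff F (degree F - 1) \<noteq> 0"
  shows "i + 1 = degree F"
proof -
  let ?G = "poly_cutoff (i + 1) F + monom c (degree F)"
  obtain q where q: "?G = F * q" using assms by blast
  have F0: "F \<noteq> 0" using assms by auto
  have "coeff ?G k = 0" if "k > degree F" for k
    using that assms by (simp add: coeff_poly_cutoff)
  hence "degree ?G \<le> degree F" by (simp add: degree_le)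
  hence "degree q = 0" using q F0 by (cases "q = 0") (auto simp: degree_mult_eq)
  then obtain d where d: "q = [:d:]" by (metis degree_0_id)
  hence coeffs: "coeff ?G k = d * coeff F k" for k using q by simp
  have "d = 1" using coeffs[of 0] assms by (simp add: coeff_poly_cutoff)
  thus ?thesis using coeffs[of "degree F - 1"] assms
    by (auto simp: coeff_poly_cutoff split: if_splits)
qed

text \<open>Multiplying by \<open>P\<close> turns the congruence modulo \<open>F\<close> into one
  modulo x^m - 1, where x^l acts as a cyclic shift. Zeros of the truncation times \<open>P\<close>
  near both ends thus become zeros of \<open>P\<close>; the index m - l is exempt because it is
  shifted to position 0.\<close>

lemma truncation_monom_above_degree:
  fixes F P :: "'a::idom poly"
  assumes FP: "F * P = monom 1 m - 1" and m: "m > 0" and F: "lead_coeff F = 1"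
    and dvd: "F dvd poly_cutoff (i + 1) F + monom c l"
    and c: "c \<noteq> 0" and i: "i < degree F" and l: "degree F < l" "l < m"
  shows "i + 1 + degree F \<le> l" "l + degree F \<le> i + m"
    "\<And>j. m - 2 * degree F \<le> j \<Longrightarrow> j \<le> degree F \<Longrightarrow> j \<noteq> m - l \<Longrightarrow> coeff P j = 0"
proof -
  define A where "A = poly_cutoff (i + 1) F"
  obtain Q where Q: "A + monom c l = F * Q" using dvd by (auto simp: A_def)
  have nz: "F \<noteq> 0" "P \<noteq> 0"
  proof -
    have "coeff (F * P) 0 \<noteq> 0" using m unfolding FP by simp
    thus "F \<noteq> 0" "P \<noteq> 0" by auto
  qed
  have degFP: "degree (F * P) = m" unfolding FP using m by (rule degree_monom_diff_1)
  hence degP: "degree F + degree P = m" using nz by (simp add: degree_mult_eq)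
  have P0: "coeff P 0 \<noteq> 0"
  proof -
    have "coeff F 0 * coeff P 0 = - 1" using m arg_cong[OF FP, of "\<lambda>f. coeff f 0"]
      by (simp add: coeff_mult_0)
    thus ?thesis by auto
  qed
  have Ptop: "coeff P (degree P) \<noteq> 0" using nz by simp
  have degA: "degree A \<le> i" by (auto intro!: degree_le simp: A_def coeff_poly_cutoff)
  have AP_high: "coeff (A * P) t = 0" if "t + degree F > i + m" for t
    using that degA degP degree_mult_le[of A P] by (intro coeff_eq_0) linarith
  \<comment> \<open>Up to index i the product agrees with \<open>F * P\<close>, which has no terms
    strictly between 0 and m.\<close>
  have AP_low: "coeff (A * P) t = 0" if "1 \<le> t" "t \<le> i" for t
  proof -
    have "coeff ((F - A) * P) t = 0"
      unfolding coeff_mult using that by (intro sum.neutral) (auto simp: A_def coeff_poly_cutoff)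
    hence "coeff (A * P) t = coeff (F * P) t" by (simp add: left_diff_distrib)
    thus ?thesis using that i l unfolding FP by (simp add: coeff_1)
  qed
  have "coeff (A + monom c l) l \<noteq> 0" using c i l by (simp add: A_def coeff_poly_cutoff)
  moreover have "degree (A + monom c l) \<le> l"
    using i l by (auto intro!: degree_le simp: A_def coeff_poly_cutoff)
  ultimately have "degree (F * Q) \<le> l" "Q \<noteq> 0" unfolding Q by auto
  hence degQ: "degree Q < m" using nz l by (simp add: degree_mult_eq)
  have eq: "A * P + monom c l * P = (monom 1 m - 1) * Q"
  proof -
    have "A * P + monom c l * P = (F * Q) * P" by (simp flip: Q add: distrib_right)
    thus ?thesis by (simp flip: FP add: mult_ac)
  qed
  have coeff_eq: "coeff (A * P) t + (if t < l then 0 else c * coeff P (t - l)) =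
      (if t < m then 0 else coeff Q (t - m)) - coeff Q t" for t
    using arg_cong[OF eq, of "\<lambda>f. coeff f t"]
    by (simp add: coeff_monom_mult left_diff_distrib split: if_splits)
  \<comment> \<open>At index m + j neither \<open>A * P\<close> nor \<open>Q\<close> contributes,
    which determines \<open>Q\<close> from \<open>P\<close>.\<close>
  have Qc: "coeff Q j = c * coeff P (m + j - l)" for j
    using coeff_eq[of "m + j"] AP_high[of "m + j"] degQ i l by (simp add: coeff_eq_0)
  have AP_wrap: "coeff (A * P) t = - c * coeff P (m + t - l)" if "t < l" for t
    using coeff_eq[of t] that l Qc[of t] by simp
  have AP_shift: "coeff (A * P) t = - c * coeff P (t - l)" if "l \<le> t" "t < m" for t
  proof -
    have "coeff P (m + t - l) = 0" using that l degP i by (intro coeff_eq_0) auto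
    thus ?thesis using coeff_eq[of t] that Qc[of t] by (simp add: eq_neg_iff_add_eq_0)
  qed
  \<comment> \<open>The nonzero constant term of \<open>P\<close> is shifted to l, which must
    respect the degree bound of \<open>A * P\<close>.\<close>
  show "l + degree F \<le> i + m"
  proof (rule ccontr)
    assume "\<not> ?thesis"
    thus False using AP_shift[of l] AP_high[of l] P0 c l by simp
  qed
  \<comment> \<open>The top coefficient of \<open>P\<close> wraps around to l - deg
    \<open>F\<close>, which must avoid the zeros at 1, ..., i.\<close>
  show "i + 1 + degree F \<le> l"
  proof (rule ccontr)
    assume "\<not> ?thesis"
    hence "coeff (A * P) (l - degree F) = 0" using l by (intro AP_low) auto
    moreover have "m + (l - degree F) - l = degree P" using degP l by simp
    ultimately show False using AP_wrap[of "l - degree F"] Ptop c i l by simp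
  qed
  fix j assume j: "m - 2 * degree F \<le> j" "j \<le> degree F" "j \<noteq> m - l"
  show "coeff P j = 0"
  \<comment> \<open>Indices below m - l are shifted beyond the degree of \<open>A * P\<close>; those
    above m - l wrap into 1, ..., i.\<close>
  proof (cases "j < m - l")
    case True
    have "coeff (A * P) (j + l) = 0"
      using j True \<open>i + 1 + degree F \<le> l\<close> \<open>l + degree F \<le> i + m\<close> by (intro AP_high) simp
    thus ?thesis using AP_shift[of "j + l"] True c by simp
  next
    case False
    have "coeff (A * P) (j + l - m) = 0"
      using j False l \<open>l + degree F \<le> i + m\<close> by (intro AP_low) auto
    moreover have "j < m" using j \<open>i + 1 + degree F \<le> l\<close> \<open>l < m\<close> by simp
    ultimately show ?thesis using AP_wrap[of "j + l - m"] False c l by simp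
  qed
qed

section \<open>Cyclotomic polynomials\<close>

text \<open>Roots split off one at a time: after division by the factor of b, the other a differ
  from b and stay roots of the quotient.\<close>

lemma prod_linear_factors_dvd_iff:
  fixes h :: "'a::idom poly"
  assumes "finite S"
  shows "(\<Prod>a\<in>S. [:- a, 1:]) dvd h \<longleftrightarrow> (\<forall>a\<in>S. poly h a = 0)"
  using assms
proof (induction S arbitrary: h rule: finite_induct)
  case (insert b S)
  show ?case
  proof
    assume "(\<Prod>a\<in>insert b S. [:- a, 1:]) dvd h"
    hence *: "[:- b, 1:] * (\<Prod>a\<in>S. [:- a, 1:]) dvd h" using insert by simp
    show "\<forall>a\<in>insert b S. poly h a = 0"
      using dvd_mult_left[OF *] dvd_mult_right[OF *] insert.IH by (auto simp: poly_eq_0_iff_dvd)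
  next
    assume *: "\<forall>a\<in>insert b S. poly h a = 0"
    then obtain g where g: "h = [:- b, 1:] * g" by (auto simp: poly_eq_0_iff_dvd)
    have "\<forall>a\<in>S. poly g a = 0" using * insert.hyps g by auto
    hence "(\<Prod>a\<in>S. [:- a, 1:]) dvd g" using insert.IH by blast
    thus "(\<Prod>a\<in>insert b S. [:- a, 1:]) dvd h"
      unfolding g prod.insert[OF insert.hyps] by (rule mult_dvd_mono[OF dvd_refl])
  qed
qed simp

section \<open>Roots of unity and primitive roots\<close>

definition root_of_unity :: "nat \<Rightarrow> nat \<Rightarrow> complex" where
  "root_of_unity N j = exp (2 * of_real pi * \<i> * of_nat j / of_nat N)"

text \<open>With \<open>totatives\<close> as index set, N = 1 correctly yields the single root
  1.\<close>

definition primitive_roots :: "nat \<Rightarrow> complex set" where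
  "primitive_roots N = root_of_unity N ` totatives N"

lemma root_of_unity_eq_iff:
  "N > 0 \<Longrightarrow> root_of_unity N j = root_of_unity N k \<longleftrightarrow> j mod N = k mod N"
  unfolding root_of_unity_def by (rule complex_root_unity_eq) simp

lemma root_of_unity_power: "root_of_unity N j ^ k = root_of_unity N (j * k)"
  unfolding root_of_unity_def by (simp add: exp_of_nat_mult[symmetric] field_simps)

lemma root_of_unity_mult_cancel:
  "k > 0 \<Longrightarrow> root_of_unity (N * k) (j * k) = root_of_unity N j"
  unfolding root_of_unity_def by (simp add: field_simps)

lemma root_of_unity_eq_1_iff: "N > 0 \<Longrightarrow> root_of_unity N j = 1 \<longleftrightarrow> N dvd j"
  unfolding root_of_unity_def by (rule complex_root_unity_eq_1) simp

lemma inj_on_root_of_unity: "N > 0 \<Longrightarrow> inj_on (root_of_unity N) (totatives N)"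
proof (rule inj_onI)
  fix j k assume *: "N > 0" "j \<in> totatives N" "k \<in> totatives N"
    "root_of_unity N j = root_of_unity N k"
  show "j = k"
  proof (cases "N = 1")
    case False
    hence "j < N" "k < N" using * totatives_less by auto
    thus ?thesis using * by (simp add: root_of_unity_eq_iff)
  qed (use * in auto)
qed

lemma finite_primitive_roots [simp]: "finite (primitive_roots N)"
  by (simp add: primitive_roots_def)

lemma root_of_unity_in_primitive_roots:
  assumes "N > 0" "coprime j N"
  shows "root_of_unity N j \<in> primitive_roots N"
proof (cases "N = 1")
  case True
  thus ?thesis by (auto simp: primitive_roots_def root_of_unity_eq_iff)
next
  case False
  hence "j mod N \<noteq> 0" 
    using assms coprime_common_divisor_nat[of j N N] by (auto simp: mod_eq_0_iff_dvd)
  hence "j mod N \<in> totatives N" using assms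
    by (auto simp: totatives_def less_imp_le)
  moreover have "root_of_unity N j = root_of_unity N (j mod N)"
    using assms by (simp add: root_of_unity_eq_iff)
  ultimately show ?thesis by (auto simp: primitive_roots_def)
qed

lemma primitive_root_power_eq_1: "z \<in> primitive_roots N \<Longrightarrow> z ^ N = 1"
proof -
  assume "z \<in> primitive_roots N"
  then obtain j where j: "z = root_of_unity N j" "j \<in> totatives N" by (auto simp: primitive_roots_def)
  hence "N > 0" by (cases "N = 0") auto
  thus ?thesis using j by (simp add: root_of_unity_power root_of_unity_eq_1_iff)
qed

lemma primitive_roots_power:
  assumes "z \<in> primitive_roots N" "coprime k N"
  shows "z ^ k \<in> primitive_roots N"
proof -
  obtain j where j: "z = root_of_unity N j" "j \<in> totatives N"
    using assms by (auto simp: primitive_roots_def)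
  hence "N > 0" by (cases "N = 0") auto
  moreover have "coprime (j * k) N" using j assms by (simp add: totatives_def)
  ultimately show ?thesis
    using j by (simp add: root_of_unity_power root_of_unity_in_primitive_roots)
qed

section \<open>Cyclotomic polynomials as products over primitive roots\<close>

lemma cyclotomic_poly_altdef:
  assumes "N > 0"
  shows "cyclotomic_poly N = (\<Prod>z\<in>primitive_roots N. [:- z, 1:])"
proof -
  have "{j. 1 \<le> j \<and> j \<le> N \<and> gcd j N = 1} = totatives N"
    by (auto simp: totatives_def coprime_iff_gcd_eq_1)
  hence "cyclotomic_poly N = (\<Prod>j\<in>totatives N. [:- root_of_unity N j, 1:])"
    by (simp add: cyclotomic_poly_def root_of_unity_def)
  thus ?thesis unfolding primitive_roots_def
    by (simp add: prod.reindex[OF inj_on_root_of_unity[OF assms]])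
qed

lemma cyclotomic_poly_dvd_iff:
  "N > 0 \<Longrightarrow> cyclotomic_poly N dvd h \<longleftrightarrow> (\<forall>z\<in>primitive_roots N. poly h z = 0)"
  by (simp add: cyclotomic_poly_altdef prod_linear_factors_dvd_iff)

lemma degree_cyclotomic_poly: "N > 0 \<Longrightarrow> degree (cyclotomic_poly N) = totient N"
  by (simp add: cyclotomic_poly_altdef degree_prod_sum_eq primitive_roots_def card_image
      inj_on_root_of_unity totient_def)

lemma lead_coeff_cyclotomic_poly: "N > 0 \<Longrightarrow> lead_coeff (cyclotomic_poly N) = 1"
  by (simp only: cyclotomic_poly_altdef lead_coeff_prod) simp

lemma cyclotomic_poly_dvd: "N > 0 \<Longrightarrow> cyclotomic_poly N dvd monom 1 N - 1"
  by (simp add: cyclotomic_poly_dvd_iff poly_monom primitive_root_power_eq_1)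

lemma cyclotomic_poly_1: "cyclotomic_poly 1 = [:-1, 1:]"
  by (simp add: cyclotomic_poly_altdef primitive_roots_def root_of_unity_eq_1_iff)

text \<open>The left side has simple zeros at the primitive roots of orders m * p and m. The p-th
  power of each is a primitive m-th root, so the left side divides the right; equal degrees and
  leading coefficients give equality.\<close>

lemma cyclotomic_poly_mult_prime:
  assumes "m > 0" "prime p" "\<not> p dvd m"
  shows "cyclotomic_poly (m * p) * cyclotomic_poly m = pcompose (cyclotomic_poly m) (monom 1 p)"
    (is "?L = ?R")
proof -
  have p: "p > 0" "p > 1" using prime_gt_1_nat[OF assms(2)] by auto
  have cop: "coprime p m" using assms by (simp add: prime_imp_coprime)
  have disj: "primitive_roots (m * p) \<inter> primitive_roots m = {}"
  proof (rule equals0I)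
    fix z assume z: "z \<in> primitive_roots (m * p) \<inter> primitive_roots m"
    then obtain j where j: "z = root_of_unity (m * p) j" "coprime j (m * p)"
      by (auto simp: primitive_roots_def totatives_def)
    moreover have "z ^ m = 1" using z primitive_root_power_eq_1 by blast
    ultimately have "m * p dvd j * m" using assms p by (simp add: root_of_unity_power root_of_unity_eq_1_iff)
    hence "p dvd j" using assms by (simp add: mult.commute)
    thus False using j p coprime_common_divisor_nat[of j "m * p" p] by auto
  qed
  have L: "?L = (\<Prod>z\<in>primitive_roots (m * p) \<union> primitive_roots m. [:- z, 1:])"
    using assms p disj by (simp add: cyclotomic_poly_altdef prod.union_disjoint)
  have root: "poly (cyclotomic_poly m) z = 0" if "z \<in> primitive_roots m" for z
    using cyclotomic_poly_dvd_iff[of m "cyclotomic_poly m"] assms that by simp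
  have "poly ?R z = 0" if "z \<in> primitive_roots (m * p) \<union> primitive_roots m" for z
  proof -
    have "z ^ p \<in> primitive_roots m"
    proof (cases "z \<in> primitive_roots m")
      case True
      thus ?thesis using cop by (rule primitive_roots_power)
    next
      case False
      with that have "z \<in> primitive_roots (m * p)" by simp
      then obtain j where j: "z = root_of_unity (m * p) j" "coprime j (m * p)"
        by (auto simp: primitive_roots_def totatives_def)
      thus ?thesis using assms p
        by (simp add: root_of_unity_power root_of_unity_mult_cancel root_of_unity_in_primitive_roots)
    qed
    thus ?thesis using root by (simp add: poly_pcompose poly_monom)
  qed
  hence "?L dvd ?R" unfolding L by (simp add: prod_linear_factors_dvd_iff)
  then obtain q where q: "?R = ?L * q" by blast
  have lc: "lead_coeff ?L = 1"
    using assms p by (simp add: lead_coeff_mult lead_coeff_cyclotomic_poly)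
  have nz: "cyclotomic_poly m \<noteq> 0" using lead_coeff_cyclotomic_poly[of m] assms by auto
  have "totient (m * p) + totient m = totient m * p"
    using assms cop p
    by (simp add: totient_mult_coprime coprime_commute totient_prime add.commute flip: mult_Suc_right)
  hence deg: "degree ?R = degree ?L"
    using assms p lc nz by (subst degree_mult_eq)
      (auto simp: degree_pcompose degree_monom_eq degree_cyclotomic_poly)
  have lcR: "lead_coeff ?R = 1"
    unfolding deg[symmetric] using assms p
    by (simp add: degree_pcompose degree_monom_eq coeff_pcompose_monom lead_coeff_cyclotomic_poly)
  have "?L \<noteq> 0" "q \<noteq> 0" using lc lcR q by auto
  hence "degree q = 0" using deg q by (simp add: degree_mult_eq)
  moreover have "lead_coeff q = 1" using lcR lc unfolding q lead_coeff_mult by simp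
  ultimately have "q = 1" by (auto elim!: degree_eq_zeroE simp: one_pCons)
  thus ?thesis using q by simp
qed

text \<open>For r inverse to p modulo m, the map from z to z^r preserves primitive m-th roots and is
  undone by the p-th power; evaluation at z^r removes the substitution.\<close>

lemma cyclotomic_poly_dvd_pcompose_imp_dvd:
  assumes "m > 0" "coprime p m"
    and dvd: "cyclotomic_poly m dvd pcompose A (monom 1 p) + monom c n"
  obtains n' where "n' < m" "[p * n' = n] (mod m)" "cyclotomic_poly m dvd A + monom c n'"
proof -
  obtain r where r: "[p * r = 1] (mod m)"
    using cong_solve_coprime_nat assms by (metis One_nat_def)
  have cop: "coprime r m"
    using r by (metis cong_imp_coprime cong_sym coprime_1_left coprime_mult_left_iff)
  define n' where "n' = r * n mod m"
  have "[p * n' = p * r * n] (mod m)"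
    by (simp add: n'_def cong_def mod_mult_right_eq mult.assoc)
  also have "[p * r * n = n] (mod m)" using cong_scalar_right[OF r, of n] by simp
  finally have n': "[p * n' = n] (mod m)" .
  have "poly (A + monom c n') z = 0" if z: "z \<in> primitive_roots m" for z
  proof -
    have pow: "z ^ k = z ^ (k mod m)" for k
    proof -
      have "z ^ k = z ^ (m * (k div m) + k mod m)" by simp
      also have "\<dots> = z ^ (k mod m)"
        unfolding power_add power_mult by (simp add: primitive_root_power_eq_1[OF z])
      finally show ?thesis .
    qed
    have "poly (pcompose A (monom 1 p) + monom c n) (z ^ r) = 0"
      using dvd primitive_roots_power[OF z cop] assms by (simp add: cyclotomic_poly_dvd_iff)
    moreover have "(z ^ r) ^ p = z"
      using pow[of "p * r"] pow[of 1] r by (simp add: cong_def mult.commute flip: power_mult)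
    moreover have "(z ^ r) ^ n = z ^ n'"
      using pow[of "r * n"] by (simp add: n'_def flip: power_mult)
    ultimately show ?thesis by (simp add: poly_pcompose poly_monom)
  qed
  hence "cyclotomic_poly m dvd A + monom c n'" using assms by (simp add: cyclotomic_poly_dvd_iff)
  moreover have "n' < m" using assms by (simp add: n'_def)
  ultimately show ?thesis using n' that by blast
qed

section \<open>Nonzero coefficients at both ends\<close>

lemma coeff_cyclotomic_poly_0: "N > 0 \<Longrightarrow> coeff (cyclotomic_poly N) 0 \<noteq> 0"
proof -
  assume N: "N > 0"
  then obtain P where "monom 1 N - 1 = cyclotomic_poly N * P" using cyclotomic_poly_dvd by blast
  from arg_cong[OF this, of "\<lambda>f. coeff f 0"] N
  have "coeff (cyclotomic_poly N) 0 * coeff P 0 = - 1" by (simp add: coeff_mult_0)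
  thus ?thesis by auto
qed

text \<open>Induction by splitting off a prime p: as p > 1, F(x^p) has no linear term and none just
  below its leading term. The linear coefficient of the product is a sum of two terms, one nonzero
  by induction, hence so is the other.\<close>

lemma coeff_cyclotomic_poly_squarefree:
  assumes "squarefree N"
  shows "coeff (cyclotomic_poly N) 1 \<noteq> 0 \<and> coeff (cyclotomic_poly N) (totient N - 1) \<noteq> 0"
  using assms
proof (induction N rule: less_induct)
  case (less N)
  show ?case
  proof (cases "N = 1")
    case True
    thus ?thesis by (simp add: cyclotomic_poly_1[unfolded One_nat_def])
  next
    case False
    then obtain p where p: "prime p" "p dvd N" using prime_factor_nat by blast
    then obtain m where m: "N = m * p" by (metis dvd_def mult.commute)
    have "N > 0" using less.prems by (intro Nat.gr0I) auto
    hence m0: "m > 0" using m by auto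
    have pm: "\<not> p dvd m"
    proof
      assume "p dvd m"
      hence "p\<^sup>2 dvd N" unfolding m power2_eq_square by (rule mult_dvd_mono) simp
      thus False using less.prems p by (auto dest: squarefreeD)
    qed
    have p1: "p > 1" using p prime_gt_1_nat by blast
    have "m < N" using m m0 p1 by simp
    moreover have "squarefree m" using less.prems m squarefree_mono[of m N] by simp
    ultimately have IH: "coeff (cyclotomic_poly m) 1 \<noteq> 0" 
        "coeff (cyclotomic_poly m) (totient m - 1) \<noteq> 0"
      using less.IH by auto
    let ?C = "cyclotomic_poly N" and ?F = "cyclotomic_poly m"
    have CF: "?C * ?F = pcompose ?F (monom 1 p)"
      unfolding m using cyclotomic_poly_mult_prime m0 p pm by blast
    have prod1: "coeff (f * g) 1 = coeff f 0 * coeff g 1 + coeff f 1 * coeff g 0"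
      for f g :: "complex poly" by (simp add: coeff_mult)
    have "coeff (?C * ?F) 1 = 0" using p1 unfolding CF by (simp add: coeff_pcompose_monom)
    hence "coeff ?C 1 \<noteq> 0"
      using IH coeff_cyclotomic_poly_0[OF \<open>N > 0\<close>] unfolding prod1 by auto
    have tot: "totient N > 0" "totient m > 0" using \<open>N > 0\<close> m0 by simp_all
    have lc: "lead_coeff ?C = 1" "lead_coeff ?F = 1"
      using \<open>N > 0\<close> m0 by (simp_all add: lead_coeff_cyclotomic_poly)
    have deg: "degree ?C = totient N" "degree ?F = totient m"
      using \<open>N > 0\<close> m0 by (simp_all add: degree_cyclotomic_poly)
    have "degree (?C * ?F) = p * totient m" 
      unfolding CF by (simp add: degree_pcompose degree_monom_eq deg)
    \<comment> \<open>Reflection turns the coefficient below the leading one into a linear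
      coefficient.\<close>
    hence "coeff (reflect_poly (?C * ?F)) 1 = coeff (?C * ?F) (p * totient m - 1)"
      using tot p1 by (simp add: coeff_reflect_poly)
    also have "\<dots> = 0"
    proof -
      have "\<not> p dvd p * totient m - 1"
      proof
        assume "p dvd p * totient m - 1"
        hence "p dvd p * totient m - (p * totient m - 1)" 
          using dvd_diff_nat[OF dvd_triv_left] by blast
        moreover have "0 < p * totient m" using tot p1 by simp
        hence "p * totient m - (p * totient m - 1) = 1" by linarith
        ultimately show False using p1 by simp
      qed
      thus ?thesis unfolding CF using p1 by (simp add: coeff_pcompose_monom)
    qed
    finally have "coeff (reflect_poly ?C) 0 * coeff (reflect_poly ?F) 1
        + coeff (reflect_poly ?C) 1 * coeff (reflect_poly ?F) 0 = 0"
      unfolding reflect_poly_mult prod1 .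
    hence "coeff ?C (totient N - 1) \<noteq> 0"
      using IH tot lc deg by (auto simp: coeff_reflect_poly)
    thus ?thesis using \<open>coeff ?C 1 \<noteq> 0\<close> by simp
  qed
qed

section \<open>The indices 3, 15 and 15 times a prime\<close>

lemma cyclotomic_poly_3: "cyclotomic_poly 3 = [:1, 1, 1:]"
proof -
  have "cyclotomic_poly (1 * 3) * cyclotomic_poly 1 = pcompose (cyclotomic_poly 1) (monom 1 3)"
    by (rule cyclotomic_poly_mult_prime) auto
  hence "cyclotomic_poly 3 * [:-1, 1:] = [:1, 1, 1:] * [:-1, 1:]"
    unfolding cyclotomic_poly_1
    by (simp add: pcompose_pCons monom_Suc numeral_eq_Suc monom_0)
  thus ?thesis by (subst (asm) mult_right_cancel) simp_all
qed

lemma cyclotomic_poly_15: "cyclotomic_poly 15 = [:1, -1, 0, 1, -1, 1, 0, -1, 1:]"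
proof -
  have "cyclotomic_poly (3 * 5) * cyclotomic_poly 3 = pcompose (cyclotomic_poly 3) (monom 1 5)"
    by (rule cyclotomic_poly_mult_prime) auto
  hence "cyclotomic_poly 15 * [:1, 1, 1:] = [:1, -1, 0, 1, -1, 1, 0, -1, 1:] * [:1, 1, 1:]"
    unfolding cyclotomic_poly_3
    by (simp add: pcompose_pCons monom_Suc numeral_eq_Suc monom_0)
  thus ?thesis by (subst (asm) mult_right_cancel) simp_all
qed

text \<open>With \<open>G\<close> of index 15, G(x^q) P = (x^(15 q) - 1) G. Below degree 2 q the
  factor G(x^q) is 1 - x^q, so P_t = P_(t-q) - G_t for q \<le> t < 2 q; the two coefficients are -1
  and 1.\<close>

lemma inverse_cyclotomic_poly_15_mult_prime:
  assumes q: "prime q" "q \<ge> 7" and P: "cyclotomic_poly (15 * q) * P = monom 1 (15 * q) - 1"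
  shows "coeff P (q + 3) \<noteq> 0" "coeff P (q + 4) \<noteq> 0"
proof -
  define G where "G = cyclotomic_poly 15"
  have "\<not> q dvd 15"
  proof
    assume "q dvd 15"
    hence "q dvd 3 * 5" by simp
    hence "q dvd 3 \<or> q dvd 5" using q(1) by (simp only: prime_dvd_mult_iff)
    thus False using q(2) by (auto dest!: dvd_imp_le)
  qed
  hence "cyclotomic_poly (15 * q) * G = pcompose G (monom 1 q)"
    unfolding G_def using q by (intro cyclotomic_poly_mult_prime) auto
  hence "pcompose G (monom 1 q) * P = G * (cyclotomic_poly (15 * q) * P)" by (simp add: mult_ac)
  hence eq: "pcompose G (monom 1 q) * P = monom 1 (15 * q) * G - G"
    unfolding P by (simp add: algebra_simps)
  have c: "coeff (pcompose G (monom 1 q) * P) t =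
      coeff P t + (if t < q then 0 else - coeff P (t - q))" if "t < 2 * q" for t
  proof -
    have "coeff (pcompose G (monom 1 q) * P) t =
       (\<Sum>i\<in>{0} \<union> (if t < q then {} else {q}). coeff (pcompose G (monom 1 q)) i * coeff P (t - i))"
      unfolding coeff_mult
    proof (rule sum.mono_neutral_right)
      show "\<forall>i\<in>{..t} - ({0} \<union> (if t < q then {} else {q})).
          coeff (pcompose G (monom 1 q)) i * coeff P (t - i) = 0"
      proof
        fix i assume i: "i \<in> {..t} - ({0} \<union> (if t < q then {} else {q}))"
        have "\<not> q dvd i"
        proof
          assume "q dvd i"
          then obtain k where k: "i = q * k" by blast
          have "i < q * 2" using i that by auto
          hence "k < 2" unfolding k by simp
          hence "k = 0 \<or> k = 1" by auto
          thus False using i k by (auto split: if_splits)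
        qed
        thus "coeff (pcompose G (monom 1 q)) i * coeff P (t - i) = 0"
          using q by (simp add: coeff_pcompose_monom)
      qed
    qed auto
    thus ?thesis using q by (auto simp: coeff_pcompose_monom G_def cyclotomic_poly_15)
  qed
  have Pt: "coeff P t = (if t < q then 0 else coeff P (t - q)) - coeff G t" if "t < 2 * q" for t
  proof -
    have "coeff (monom 1 (15 * q) * G) t = 0" using that by (simp add: coeff_monom_mult)
    hence "coeff P t = - coeff G t - (if t < q then 0 else - coeff P (t - q))"
      using c[OF that] unfolding eq by (simp add: eq_diff_eq)
    thus ?thesis by simp
  qed
  \<comment> \<open>Since q is at least 7, both indices exceed 8, the degree of
    \<open>G\<close>.\<close>
  have "coeff G (q + 3) = 0" "coeff G (q + 4) = 0"
    using q by (auto intro!: coeff_eq_0 simp: G_def cyclotomic_poly_15)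
  moreover have "coeff G 3 = 1" "coeff G 4 = -1"
    unfolding G_def cyclotomic_poly_15 by (simp_all add: numeral_eq_Suc)
  ultimately show "coeff P (q + 3) \<noteq> 0" "coeff P (q + 4) \<noteq> 0"
    using q Pt[of "q + 3"] Pt[of "q + 4"] Pt[of 3] Pt[of 4] by auto
qed

section \<open>The maximum gap\<close>

lemma totient_15_mult_prime:
  assumes "prime q" "q \<ge> 7"
  shows "totient (15 * q) = 8 * (q - 1)"
proof -
  have "coprime (3 * 5) q"
    using assms primes_coprime[of 3 q] primes_coprime[of 5 q]
    by (simp only: coprime_mult_left_iff) simp
  hence "totient (3 * 5 * q) = totient (3 * 5) * totient q" by (rule totient_mult_coprime)
  also have "totient (3 * 5) = totient 3 * totient 5"
    by (intro totient_mult_coprime primes_coprime) auto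
  finally show ?thesis using assms by (simp add: totient_prime)
qed

text \<open>The assumption \<open>small\<close> isolates what the bound 1000 provides; it enters
  where the exponent l exceeds \<open>totient m\<close>.\<close>

lemma max_gap_cyclotomic_poly_mult_prime:
  assumes sqf: "squarefree m" and p: "prime p" "\<not> p dvd m"
    and small: "2 * totient m < m \<Longrightarrow> m \<in> {105, 165, 195}"
  shows "max_gap (cyclotomic_poly (m * p)) = totient m \<longleftrightarrow> m < p"
proof -
  define F where "F = cyclotomic_poly m"
  define C where "C = cyclotomic_poly (m * p)"
  define \<phi> where "\<phi> = totient m"
  define A where "A = (\<lambda>n. poly_cutoff ((n - 1) div p + 1) F)"
  have m: "m > 0" using sqf by (intro Nat.gr0I) auto
  have p1: "p > 1" using p prime_gt_1_nat by blast
  have cop: "coprime p m" using p by (simp add: prime_imp_coprime)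
  have \<phi>: "\<phi> > 0" using m by (simp add: \<phi>_def)
  have lc: "lead_coeff F = 1" unfolding F_def using m by (rule lead_coeff_cyclotomic_poly)
  have F: "degree F = \<phi>" "lead_coeff F = 1" "coeff F 0 \<noteq> 0"
    "coeff F 1 \<noteq> 0" "coeff F (\<phi> - 1) \<noteq> 0"
    using m coeff_cyclotomic_poly_squarefree[OF sqf] lc
    by (simp_all add: F_def \<phi>_def degree_cyclotomic_poly coeff_cyclotomic_poly_0)
  have CF: "C * F = pcompose F (monom 1 p)"
    unfolding C_def F_def using m p by (rule cyclotomic_poly_mult_prime)
  have degC: "degree C = \<phi> * (p - 1)"
    using m p p1 cop
    by (simp add: C_def degree_cyclotomic_poly totient_mult_coprime totient_prime \<phi>_def
        coprime_commute)
  obtain P where FP: "F * P = monom 1 m - 1"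
    using cyclotomic_poly_dvd[OF m] unfolding F_def by (metis dvd_def)
  have window: "(b - 1) div p < \<phi> \<and>
      (\<exists>l<m. [p * l = b] (mod m) \<and> F dvd A b + monom (coeff C (b - \<phi>)) l)"
    if ab: "consecutive_exponents C a b" "\<phi> \<le> b - a" for a b
  proof -
    have zero: "coeff C j = 0" if "b - \<phi> < j" "j < b" for j
      using ab that unfolding consecutive_exponents_def by auto
    have "F dvd pcompose (A b) (monom 1 p) + monom (coeff C (b - degree F)) b"
      unfolding A_def using ab zero p1 \<phi> F by (intro dvd_truncation_if_window[OF CF]) auto
    hence "F dvd pcompose (A b) (monom 1 p) + monom (coeff C (b - \<phi>)) b" by (simp add: F)
    then obtain l where "l < m" "[p * l = b] (mod m)" "F dvd A b + monom (coeff C (b - \<phi>)) l"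
      unfolding F_def by (rule cyclotomic_poly_dvd_pcompose_imp_dvd[OF m cop])
    \<comment> \<open>The truncation is proper, because b is at most deg \<open>C\<close>, which is
      below \<open>\<phi> * p\<close>.\<close>
    moreover have "(b - 1) div p < \<phi>"
    proof -
      have "b \<le> \<phi> * (p - 1)"
        using ab le_degree[of C b] by (simp add: consecutive_exponents_def degC)
      moreover have "\<phi> * (p - 1) < \<phi> * p" using \<phi> p1 by simp
      ultimately have "b - 1 < \<phi> * p" by linarith
      thus ?thesis by (simp add: less_mult_imp_div_less)
    qed
    ultimately show ?thesis by blast
  qed
  have le: "b - a \<le> \<phi>" if ab: "consecutive_exponents C a b" for a b
  proof (rule ccontr)
    assume *: "\<not> b - a \<le> \<phi>"
    obtain l where l: "l < m" "F dvd A b + monom (coeff C (b - \<phi>)) l"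
      and i: "(b - 1) div p < \<phi>" using window[OF ab] * by auto
    have "a < b - \<phi>" "b - \<phi> < b" using * \<phi> by auto
    hence "coeff C (b - \<phi>) = 0" using ab by (simp add: consecutive_exponents_def)
    \<comment> \<open>The zero monomial may be given exponent 0, which is below deg \<open>F\<close>
      as \<open>truncation_eq_monom\<close> demands.\<close>
    hence "F dvd poly_cutoff ((b - 1) div p + 1) F + monom 0 0" using l by (simp add: A_def)
    hence "poly_cutoff ((b - 1) div p + 1) F + monom 0 0 = 0"
      using i \<phi> F by (intro truncation_eq_monom) auto
    hence "coeff (poly_cutoff ((b - 1) div p + 1) F) 0 = 0" by simp
    thus False using F by (simp add: coeff_poly_cutoff)
  qed
  have "(\<exists>a. consecutive_exponents C a (a + \<phi>)) \<longleftrightarrow> m < p"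
  proof
    assume mp: "m < p"
    have coeff_P: "coeff F 0 * coeff P 0 = - 1"
      using arg_cong[OF FP, of "\<lambda>f. coeff f 0"] m by (simp add: coeff_mult_0)
    hence nz: "P \<noteq> 0" "F \<noteq> 0" using F by auto
    have "degree (F * P) = m" unfolding FP using m by (rule degree_monom_diff_1)
    hence degP: "degree P + \<phi> = m" using nz F by (simp add: degree_mult_eq)
    have "(C * F) * P = monom 1 m * C - C"
      unfolding mult.assoc FP by (simp add: algebra_simps)
    hence eq: "pcompose F (monom 1 p) * P = monom 1 m * C - C" by (simp add: CF)
    \<comment> \<open>Below degree p the factor F(x^p) is just the constant term of
      \<open>F\<close>.\<close>
    have *: "coeff F 0 * coeff P t = (if t < m then 0 else coeff C (t - m)) - coeff C t"
      if "t < p" for t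
    proof -
      have "coeff (pcompose F (monom 1 p) * P) t = coeff (pcompose F (monom 1 p)) 0 * coeff P (t - 0)"
        using that p1 by (intro coeff_mult_eq_single) (auto simp: coeff_pcompose_monom dest!: dvd_imp_le)
      thus ?thesis using p1 
        by (auto simp: eq coeff_monom_mult poly_0_coeff_0 split: if_splits)
    qed
    have C: "coeff C t = - coeff F 0 * coeff P t" if "t < m" for t
      using *[of t] that mp by simp
    \<comment> \<open>\<open>P\<close> has degree \<open>m - \<phi>\<close> and so vanishes at
      m.\<close>
    have "coeff C m = coeff C 0"
      using *[of m] mp degP \<phi> by (simp add: coeff_eq_0)
    hence "coeff C m \<noteq> 0" using C[of 0] coeff_P m by simp
    moreover have "coeff C (degree P) \<noteq> 0" using C[of "degree P"] degP \<phi> nz F by simp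
    moreover have "coeff C j = 0" if "degree P < j" "j < m" for j
      using C[of j] that by (simp add: coeff_eq_0)
    ultimately have "consecutive_exponents C (degree P) (degree P + \<phi>)"
      using degP \<phi> by (auto simp: consecutive_exponents_def)
    thus "\<exists>a. consecutive_exponents C a (a + \<phi>)" by blast
  next
    assume "\<exists>a. consecutive_exponents C a (a + \<phi>)"
    then obtain a where a: "consecutive_exponents C a (a + \<phi>)" by blast
    define n where "n = a + \<phi>"
    define i where "i = (n - 1) div p"
    define c where "c = coeff C a"
    have c: "c \<noteq> 0" using a by (simp add: c_def consecutive_exponents_def)
    have n: "0 < n" "n \<le> degree C"
      using a \<phi> by (auto simp: n_def consecutive_exponents_def intro: le_degree)
    obtain l where i: "i < \<phi>" and l: "l < m" "[p * l = n] (mod m)"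
      and dvd: "F dvd poly_cutoff (i + 1) F + monom c l"
      using window[OF a] by (auto simp: n_def i_def A_def c_def)
    have n_lower: "p * i < n" and n_upper: "n \<le> p * i + p"
    proof -
      have "p * i \<le> n - 1" by (simp add: i_def)
      thus "p * i < n" using n by linarith
      have "n - 1 < p * i + p" using p1 dividend_less_times_div[of p "n - 1"]
        by (simp add: i_def add.commute)
      thus "n \<le> p * i + p" using n by linarith
    qed
    \<comment> \<open>Makes the bound m \<le> p of the first case strict.\<close>
    have "m \<noteq> p" using p by auto
    show "m < p"
    proof (cases l \<phi> rule: linorder_cases)
      case less
      hence A: "coeff (poly_cutoff (i + 1) F + monom c l) k = 0" for k
        using truncation_eq_monom[OF dvd] i F by simp
      \<comment> \<open>The sum vanishes identically: its constant term cancels only if l = 0, and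
        then its linear term vanishes only if i = 0.\<close>
      have "l = 0" using A[of 0] F(3) by (auto simp: coeff_poly_cutoff split: if_splits)
      moreover have "i = 0"
        using A[of 1] F(4) \<open>l = 0\<close> by (auto simp: coeff_poly_cutoff split: if_splits)
      ultimately have "m dvd n" "n \<le> p" using l n_upper
        by (auto simp: cong_def mod_eq_0_iff_dvd)
      thus ?thesis using n \<open>m \<noteq> p\<close> by (auto dest!: dvd_imp_le)
    next
      case equal
      have "i + 1 = \<phi>"
        using truncation_monom_degree[of F i c] dvd equal i F by simp
      hence "p * \<phi> = p * i + p" by (simp flip: \<open>i + 1 = \<phi>\<close>)
      moreover have "n < p * \<phi>"
      proof -
        have "n \<le> \<phi> * (p - 1)" using n(2) degC by simp
        also have "\<dots> < p * \<phi>" using \<phi> p1 by simp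
        finally show ?thesis .
      qed
      \<comment> \<open>As i is \<open>\<phi> - 1\<close>, n exceeds \<open>p * \<phi> - p\<close>,
        so this positive multiple of m is less than p.\<close>
      moreover have "m dvd p * \<phi> - n"
        using l equal \<open>n < p * \<phi>\<close> by (simp add: cong_altdef_nat)
      ultimately have "m \<le> p * \<phi> - n" "p * \<phi> - n < p"
        using n_lower by (auto intro: dvd_imp_le)
      thus ?thesis by simp
    next
      case greater
      note bounds = truncation_monom_above_degree[OF FP m F(2) dvd c]
      have "i + 1 + \<phi> \<le> l" "l + \<phi> \<le> i + m"
        and zero: "\<And>j. m - 2 * \<phi> \<le> j \<Longrightarrow> j \<le> \<phi> \<Longrightarrow> j \<noteq> m - l \<Longrightarrow> coeff P j = 0"
        using bounds i greater l unfolding F(1) by auto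
      \<comment> \<open>Adding the two bounds gives \<open>2 * \<phi> < m\<close>.\<close>
      hence "m \<in> {105, 165, 195}" by (intro small) (simp flip: \<phi>_def)
      hence "m = 15 * 7 \<or> m = 15 * 11 \<or> m = 15 * 13" by simp
      then obtain q where q: "q \<in> {7, 11, 13}" "m = 15 * q" by blast
      have prime: "prime q" "7 \<le> q" using q(1) by auto
      have \<phi>_q: "\<phi> = 8 * (q - 1)" unfolding \<phi>_def q(2) using prime by (rule totient_15_mult_prime)
      have "coeff P (q + 3) \<noteq> 0" "coeff P (q + 4) \<noteq> 0"
        using inverse_cyclotomic_poly_15_mult_prime[OF prime, of P] FP
        unfolding F_def q(2) by simp_all
      \<comment> \<open>Here \<open>m - 2 * \<phi>\<close> is 16 - q. Both indices lie in the
        window, yet only one can equal m - l, so this case is contradictory.\<close>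
      moreover have "m - 2 * \<phi> \<le> q + 3" "q + 4 \<le> \<phi>" using q \<phi>_q by auto
      ultimately have "q + 3 = m - l" "q + 4 = m - l"
        using zero[of "q + 3"] zero[of "q + 4"] by auto
      thus ?thesis by simp
    qed
  qed
  thus ?thesis using le max_gap_eq_iff[OF \<phi>, of C] unfolding C_def \<phi>_def by auto
qed

section \<open>Products of odd primes with small totient\<close>

text \<open>Four odd primes already give at least 3 * 5 * 7 * 11 = 1155. With at most two, the
  product of the ratios (p - 1) / p exceeds 1/2; with three it is below 1/2 only for 3, 5 and a
  prime below 16.\<close>

lemma odd_prime_product_totient_small:
  fixes p :: "nat \<Rightarrow> nat"
  assumes p: "\<And>i. i \<in> {1..n} \<Longrightarrow> prime (p i) \<and> odd (p i)" "strict_mono_on {1..n} p"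
    and small: "(\<Prod>i = 1..n. p i) < 1000"
    and tot: "2 * totient (\<Prod>i = 1..n. p i) < (\<Prod>i = 1..n. p i)"
  shows "(\<Prod>i = 1..n. p i) \<in> {105, 165, 195}"
proof -
  have mono: "p i < p j" if "1 \<le> i" "i < j" "j \<le> n" for i j
    using that p(2) by (auto simp: strict_mono_on_def)
  have step: "p i + 2 \<le> p j" if "1 \<le> i" "i < j" "j \<le> n" for i j
    using mono[OF that] p(1)[of i] p(1)[of j] that by (auto elim!: oddE)
  have three: "3 \<le> p 1" if "1 \<le> n"
    using p(1)[of 1] that prime_ge_2_nat[of "p 1"] by (auto elim!: oddE)
  have tot2: "totient (a * b) = (a - 1) * (b - 1)" if "prime a" "prime b" "a < b" for a b :: nat
    using that by (simp add: totient_mult_coprime primes_coprime totient_prime)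
  have "\<not> 4 \<le> n"
  proof
    assume n: "4 \<le> n"
    \<comment> \<open>Parity alone gives only 9 as lower bound; excluding 9 raises it to 11.\<close>
    have "p 4 \<noteq> 9"
      using p(1)[of 4] n by auto
    hence ge: "3 \<le> p 1" "5 \<le> p 2" "7 \<le> p 3" "11 \<le> p 4"
      using three step[of 1 2] step[of 2 3] step[of 3 4] p(1)[of 4] n by (auto elim!: oddE)
    have "3 * 5 * 7 * 11 \<le> p 1 * p 2 * p 3 * p 4" by (intro mult_le_mono ge)
    also have "\<dots> = (\<Prod>i = 1..4. p i)" by (simp add: numeral_eq_Suc)
    also have "\<dots> \<le> (\<Prod>i = 1..n. p i)"
    proof (rule dvd_imp_le)
      show "(\<Prod>i = 1..4. p i) dvd (\<Prod>i = 1..n. p i)" using n by (intro prod_dvd_prod_subset) auto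
      show "0 < (\<Prod>i = 1..n. p i)" using p(1) by (intro prod_pos) (auto simp: prime_gt_0_nat)
    qed
    finally show False using small by simp
  qed
  then consider "n = 0" | "n = 1" | "n = 2" | "n = 3" by linarith
  thus ?thesis
  proof cases
    case 1
    thus ?thesis using tot by simp
  next
    case 2
    thus ?thesis using tot p(1)[of 1] three by (simp add: totient_prime)
  next
    case 3
    define a b where "a = p 1" and "b = p 2"
    have eq: "(\<Prod>i = 1..n. p i) = a * b" using 3 by (simp add: numeral_eq_Suc a_def b_def)
    have pr: "prime a" "prime b" "a < b"
      using p(1) mono[of 1 2] 3 by (simp_all add: a_def b_def)
    have "3 \<le> a" "5 \<le> b" using three step[of 1 2] 3 by (simp_all add: a_def b_def)
    \<comment> \<open>Shifting by the lower bounds makes the inequality a comparison of polynomials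
      with nonnegative coefficients.\<close>
    then obtain x y where "a = x + 3" "b = y + 5" by (metis le_add_diff_inverse2)
    hence False using tot tot2[OF pr] unfolding eq by (simp add: algebra_simps)
    thus ?thesis ..
  next
    case 4
    define a b c where "a = p 1" and "b = p 2" and "c = p 3"
    have eq: "(\<Prod>i = 1..n. p i) = a * b * c"
      using 4 by (simp add: numeral_eq_Suc a_def b_def c_def)
    have pr: "prime a" "prime b" "prime c" "odd a" "odd b" "odd c"
      using p(1) 4 by (simp_all add: a_def b_def c_def)
    have ord: "3 \<le> a" "a + 2 \<le> b" "b + 2 \<le> c"
      using three step[of 1 2] step[of 2 3] 4 by (simp_all add: a_def b_def c_def)
    have "totient (a * b * c) = (a - 1) * (b - 1) * (c - 1)"
    proof -
      have "coprime (a * b) c" using pr ord by (simp add: primes_coprime)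
      thus ?thesis using pr ord tot2[of a b]
        by (simp add: totient_mult_coprime totient_prime)
    qed
    hence less: "2 * ((a - 1) * (b - 1) * (c - 1)) < a * b * c"
      using tot unfolding eq by (simp only:)
    have "a = 3"
    proof (rule ccontr)
      assume "a \<noteq> 3"
      hence "5 \<le> a" "7 \<le> b" "9 \<le> c" using ord pr by (auto elim!: oddE)
      then obtain x y z where "a = x + 5" "b = y + 7" "c = z + 9" by (metis le_add_diff_inverse2)
      thus False using less by (simp add: algebra_simps)
    qed
    moreover have "b = 5"
    proof (rule ccontr)
      assume "b \<noteq> 5"
      hence "7 \<le> b" "9 \<le> c" using ord pr \<open>a = 3\<close> by (auto elim!: oddE)
      then obtain y z where "b = y + 7" "c = z + 9" by (metis le_add_diff_inverse2)
      thus False using less \<open>a = 3\<close> by (simp add: algebra_simps)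
    qed
    moreover have "c \<in> {7, 11, 13}"
    proof -
      \<comment> \<open>The inequality now reads 16 * (c - 1) < 15 * c.\<close>
      have "c < 16" using less \<open>a = 3\<close> \<open>b = 5\<close> by simp
      moreover have "c \<noteq> 9" "c \<noteq> 15" using pr by auto
      ultimately show ?thesis using ord pr \<open>b = 5\<close> by (auto elim!: oddE)
    qed
    ultimately show ?thesis unfolding eq by auto
  qed
qed

theorem theorem8:
  fixes k :: nat and p :: "nat \<Rightarrow> nat"
  assumes "k \<ge> 1"
    and "\<And>i. i \<in> {1..k} \<Longrightarrow> prime (p i) \<and> odd (p i)"
    and "strict_mono_on {1..k} p"
    and "(\<Prod>i = 1..k - 1. p i) < 1000"
  shows "max_gap (cyclotomic_poly (\<Prod>i = 1..k. p i)) = totient (\<Prod>i = 1..k - 1. p i)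
    \<longleftrightarrow> p k > (\<Prod>i = 1..k - 1. p i)"
proof -
  \<comment> \<open>For k = 1 this is the empty product 1.\<close>
  define m where "m = (\<Prod>i = 1..k - 1. p i)"
  have distinct: "p i \<noteq> p j" if "i \<in> {1..k}" "j \<in> {1..k}" "i \<noteq> j" for i j
    using that strict_mono_on_eqD[OF assms(3)] by blast
  have "{1..k} = insert k {1..k - 1}" using assms(1) by auto
  hence prod: "(\<Prod>i = 1..k. p i) = m * p k"
    using assms(1) by (simp add: m_def mult.commute)
  have sqf: "squarefree m" unfolding m_def
  proof (rule squarefree_prod_coprime)
    fix i j assume "i \<in> {1..k - 1}" "j \<in> {1..k - 1}" "i \<noteq> j"
    thus "coprime (p i) (p j)" using assms(2) distinct by (intro primes_coprime) auto
  next
    fix i assume "i \<in> {1..k - 1}"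
    thus "squarefree (p i)" using assms(2) by (intro squarefree_prime) auto
  qed
  have pk: "prime (p k)" using assms(1,2) by auto
  have ndvd: "\<not> p k dvd m"
  proof
    assume "p k dvd m"
    then obtain i where i: "i \<in> {1..k - 1}" "p k dvd p i"
      using pk unfolding m_def by (auto simp: prime_dvd_prod_iff)
    moreover have "prime (p i)" using assms(2) i by auto
    ultimately have "p k = p i" using pk primes_dvd_imp_eq by blast
    moreover have "k \<noteq> i" "i \<in> {1..k}" "k \<in> {1..k}" using i assms(1) by auto
    ultimately show False using distinct by blast
  qed
  have "m \<in> {105, 165, 195}" if "2 * totient m < m"
    unfolding m_def
  proof (rule odd_prime_product_totient_small)
    show "strict_mono_on {1..k - 1} p"
      using assms(3) by (rule monotone_on_subset) auto
  qed (use assms(2,4) that in \<open>auto simp: m_def\<close>)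
  hence "max_gap (cyclotomic_poly (m * p k)) = totient m \<longleftrightarrow> m < p k"
    by (intro max_gap_cyclotomic_poly_mult_prime sqf pk ndvd)
  thus ?thesis unfolding prod m_def .
qed

end
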